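(* Let $\Gamma\subset\mathbb{C}$ be an unbounded asymptotically conformal quasicircle. Then its Hausdorff dimension satisfies $\dim_H(\Gamma)=1$.
   Context: An unbounded quasicircle is a Jordan curve through $\infty$ that is the image of the (extended) real line under a quasiconformal self-homeomorphism of $\mathbb{C}$; $\Gamma$ denotes its part in $\mathbb{C}$. For $a,b\in\Gamma$, $\overset{\frown}{ab}$ is the bounded subarc of $\Gamma$ joining $a$ and $b$. The quasicircle $\Gamma$ is asymptotically conformal if $$\lim_{|a-b|\to0}\ \max_{w\in\overset{\frown}{ab}}\frac{|a-w|+|w-b|}{|a-b|}=1$$ uniformly for $a,b\in\Gamma$. *)

theory Defs
  imports "HOL-Analysis.Analysis"
begin

section \<open>Hausdorff dimension\<close>

(* The d-th power of the diameter of U. Both exceptions concern d = 0 or U = {}: the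
   empty set contributes nothing to a cover, and every nonempty set contributes 1 to the
   0-dimensional measure (whereas 0 powr 0 = 0 in the library). *)
definition hausdorff_gauge :: "real \<Rightarrow> 'a::metric_space set \<Rightarrow> ennreal" where
  "hausdorff_gauge d U =
     (if U = {} then 0 else if d = 0 then 1 else ennreal (diameter U powr d))"

(* Covers consist of bounded sets, since diameter is unspecified on unbounded ones. *)
definition hausdorff_premeasure :: "real \<Rightarrow> real \<Rightarrow> 'a::metric_space set \<Rightarrow> ennreal" where
  "hausdorff_premeasure d \<delta> A =
     (INF U \<in> {U :: nat \<Rightarrow> 'a set. A \<subseteq> (\<Union>i. U i) \<and> (\<forall>i. bounded (U i) \<and> diameter (U i) \<le> \<delta>)}.
        (\<Sum>i. hausdorff_gauge d (U i)))"

definition hausdorff_measure :: "real \<Rightarrow> 'a::metric_space set \<Rightarrow> ennreal" where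
  "hausdorff_measure d A = (SUP \<delta> \<in> {0<..}. hausdorff_premeasure d \<delta> A)"

definition hausdorff_dim :: "'a::metric_space set \<Rightarrow> ennreal" where
  "hausdorff_dim A = (INF d \<in> {d. 0 \<le> d \<and> hausdorff_measure d A = 0}. ennreal d)"


section \<open>Quasiconformal homeomorphisms of the plane\<close>

definition abs_continuous_on_interval ::
    "real \<Rightarrow> real \<Rightarrow> (real \<Rightarrow> 'a::metric_space) \<Rightarrow> bool" where
  "abs_continuous_on_interval a b g \<longleftrightarrow>
     (\<forall>e>0. \<exists>d>0. \<forall>I :: (real \<times> real) set.
        finite I \<longrightarrow>
        (\<forall>(s, t) \<in> I. a \<le> s \<and> s \<le> t \<and> t \<le> b) \<longrightarrow>
        pairwise (\<lambda>(s, t) (s', t'). disjnt {s<..<t} {s'<..<t'}) I \<longrightarrow>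
        (\<Sum>(s, t) \<in> I. t - s) < d \<longrightarrow>
        (\<Sum>(s, t) \<in> I. dist (g s) (g t)) < e)"

(* ACL: absolutely continuous on almost all horizontal and vertical segments. *)
definition abs_continuous_on_lines :: "(complex \<Rightarrow> complex) \<Rightarrow> bool" where
  "abs_continuous_on_lines f \<longleftrightarrow>
     (\<forall>a b. (AE y in lborel. abs_continuous_on_interval a b (\<lambda>x. f (Complex x y))) \<and>
            (AE x in lborel. abs_continuous_on_interval a b (\<lambda>y. f (Complex x y))))"

definition partial_Re :: "(complex \<Rightarrow> complex) \<Rightarrow> complex \<Rightarrow> complex" where
  "partial_Re f z = vector_derivative (\<lambda>x. f (Complex x (Im z))) (at (Re z))"

definition partial_Im :: "(complex \<Rightarrow> complex) \<Rightarrow> complex \<Rightarrow> complex" where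
  "partial_Im f z = vector_derivative (\<lambda>y. f (Complex (Re z) y)) (at (Im z))"

definition wirtinger_dz :: "(complex \<Rightarrow> complex) \<Rightarrow> complex \<Rightarrow> complex" where
  "wirtinger_dz f z = (partial_Re f z - \<i> * partial_Im f z) / 2"

definition wirtinger_dzbar :: "(complex \<Rightarrow> complex) \<Rightarrow> complex \<Rightarrow> complex" where
  "wirtinger_dzbar f z = (partial_Re f z + \<i> * partial_Im f z) / 2"

(* The analytic definition (Ahlfors): an ACL homeomorphism whose Beltrami coefficient is
   bounded away from 1. For an ACL map the partial derivatives exist almost everywhere,
   so that the values of vector_derivative at the other points do not matter. *)
definition quasiconformal :: "(complex \<Rightarrow> complex) \<Rightarrow> bool" where
  "quasiconformal f \<longleftrightarrow>
     (\<exists>g. homeomorphism UNIV UNIV f g) \<and>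
     abs_continuous_on_lines f \<and>
     (\<exists>k. 0 \<le> k \<and> k < 1 \<and>
        (AE z in lborel. norm (wirtinger_dzbar f z) \<le> k * norm (wirtinger_dz f z)))"


section \<open>Unbounded quasicircles\<close>

(* The finite part of the curve. A self-homeomorphism of the plane extends to the Riemann
   sphere fixing the point at infinity, so adjoining that point to the image of the real
   line always gives a Jordan curve through infinity. *)
definition unbounded_quasicircle :: "complex set \<Rightarrow> bool" where
  "unbounded_quasicircle \<Gamma> \<longleftrightarrow> (\<exists>f. quasiconformal f \<and> \<Gamma> = f ` \<real>)"

(* The subarc of \<Gamma> joining two distinct points a and b: as path images lie in the
   plane, the arc through infinity is excluded. See subarc_homeomorphic_image below for
   existence and uniqueness. *)
definition subarc :: "complex set \<Rightarrow> complex \<Rightarrow> complex \<Rightarrow> complex set" where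
  "subarc \<Gamma> a b =
     (THE A. \<exists>g. arc g \<and> path_image g \<subseteq> \<Gamma> \<and> pathstart g = a \<and> pathfinish g = b \<and>
                A = path_image g)"

definition asymptotically_conformal :: "complex set \<Rightarrow> bool" where
  "asymptotically_conformal \<Gamma> \<longleftrightarrow>
     (\<forall>e>0. \<exists>d>0. \<forall>a\<in>\<Gamma>. \<forall>b\<in>\<Gamma>. 0 < norm (a - b) \<and> norm (a - b) < d \<longrightarrow>
        \<bar>(SUP w \<in> subarc \<Gamma> a b. (norm (a - w) + norm (w - b)) / norm (a - b)) - 1\<bar> < e)"

lemma subarc_homeomorphic_image:
  fixes f h :: "complex \<Rightarrow> complex" and s t :: real
  assumes f: "homeomorphism UNIV UNIV f h" and st: "s \<noteq> t"
  shows "subarc (f ` \<real>) (f (of_real s)) (f (of_real t)) = (f \<circ> of_real) ` closed_segment s t"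
proof -
  have contf: "continuous_on UNIV f" and conth: "continuous_on UNIV h"
    and hf: "\<And>x. h (f x) = x"
    using f by (auto simp: homeomorphism_def)
  have injf: "inj f" by (metis hf injI)
  let ?l = "linepath s t"
  let ?g0 = "(f \<circ> of_real) \<circ> ?l"
  have arc0: "arc ?g0"
  proof -
    have "continuous_on (path_image ?l) (f \<circ> of_real)"
      by (rule continuous_on_compose[OF continuous_on_of_real[OF continuous_on_id] continuous_on_subset[OF contf]]) simp
    moreover have "inj_on (f \<circ> of_real) (path_image ?l)"
      by (auto intro!: inj_onI dest!: injD[OF injf])
    ultimately show ?thesis
      using arc_linepath[OF st] unfolding arc_def
      by (metis comp_inj_on path_continuous_image path_image_def)
  qed
  have pi0: "path_image ?g0 = (f \<circ> of_real) ` closed_segment s t"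
    by (simp only: path_image_compose path_image_linepath)
  have uniq: "path_image g = (f \<circ> of_real) ` closed_segment s t"
    if g: "arc g" "path_image g \<subseteq> f ` \<real>" "pathstart g = f (of_real s)"
      "pathfinish g = f (of_real t)" for g
  proof -
    define k where "k = Re \<circ> (h \<circ> g)"
    have gk: "g u = f (of_real (k u))" if "u \<in> {0..1}" for u
    proof -
      have "g u \<in> f ` \<real>" using g(2) that by (auto simp: path_image_def)
      then show ?thesis by (auto simp: k_def hf Reals_def)
    qed
    have contk: "continuous_on {0..1} k"
      unfolding k_def
      by (intro continuous_on_compose continuous_intros continuous_on_subset[OF conth]
            arc_imp_path[OF g(1), unfolded path_def]) auto
    have injk: "inj_on k {0..1}"
      using g(1) gk unfolding arc_def inj_on_def by metis
    have "k ` closed_segment 0 1 = closed_segment (k 0) (k 1)"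
      by (rule continuous_injective_image_segment_1)
        (use contk injk in \<open>auto simp: closed_segment_eq_real_ivl\<close>)
    moreover have "k 0 = s" "k 1 = t"
      using g(3,4) by (simp_all add: k_def pathstart_def pathfinish_def hf)
    ultimately have "k ` {0..1} = closed_segment s t"
      by (simp add: closed_segment_eq_real_ivl)
    moreover have "path_image g = (f \<circ> of_real) ` k ` {0..1}"
      using gk by (auto simp: path_image_def image_image)
    ultimately show ?thesis by simp
  qed
  have sub0: "path_image ?g0 \<subseteq> f ` \<real>"
    unfolding pi0 by auto
  show ?thesis
    unfolding subarc_def
  proof (rule the_equality)
    show "\<exists>g. arc g \<and> path_image g \<subseteq> f ` \<real> \<and> pathstart g = f (of_real s) \<and>
      pathfinish g = f (of_real t) \<and> (f \<circ> of_real) ` closed_segment s t = path_image g"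
      using arc0 sub0 pi0 by (intro exI[of _ ?g0]) (simp add: pathstart_def pathfinish_def linepath_def)
  qed (use uniq in blast)
qed

end

theory Submission
  imports Defs
begin

text \<open>
  Only the parametrization of \<open>\<Gamma>\<close> by a continuous injective function on the line is needed,
  not the distortion of the quasiconformal map. Fix \<open>p > 1\<close> and \<open>c > 1\<close> with
  \<open>2 (c / 2)\<^sup>p < 1\<close>. By asymptotic conformality, any point \<open>w\<close> of an arc with short chord
  \<open>ab\<close> satisfies \<open>|a - w| + |w - b| \<le> c |a - b|\<close>. Splitting the arc at a point equidistant
  from \<open>a\<close> and \<open>b\<close> therefore gives two arcs whose chords are shorter by the factor \<open>c / 2\<close>.
  After \<open>n\<close> bisections there are \<open>2\<^sup>n\<close> arcs of diameter \<open>O((c / 2)\<^sup>n)\<close>, and the sum of the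
  \<open>p\<close>-th powers of their diameters tends to \<open>0\<close>. Conversely, a connected set with two points
  \<open>x\<close> and \<open>y\<close> is mapped by the 1-Lipschitz function \<open>dist x\<close> onto a set containing
  \<open>[0, dist x y]\<close>, so that its dimension is at least \<open>1\<close>.
\<close>

section \<open>Null sets of the Hausdorff measure\<close>

lemma hausdorff_premeasure_le:
  assumes "A \<subseteq> (\<Union>i. U i)" "\<And>i. bounded (U i)" "\<And>i. diameter (U i) \<le> \<delta>"
  shows "hausdorff_premeasure d \<delta> A \<le> (\<Sum>i. hausdorff_gauge d (U i))"
  unfolding hausdorff_premeasure_def by (rule INF_lower) (use assms in auto)

lemma hausdorff_measure_eq_0_iff:
  "hausdorff_measure d A = 0 \<longleftrightarrow> (\<forall>\<delta>>0. hausdorff_premeasure d \<delta> A = 0)"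
  unfolding hausdorff_measure_def by (auto simp: SUP_eq_iff simp flip: bot_ennreal)

text \<open>Each \<open>A i\<close> has an admissible cover of gauge sum below
  \<open>e / 2 ^ Suc i\<close>. The pairing \<open>prod_decode\<close> merges these covers into a
  single sequence, at the same scale \<delta> and with gauge sum at most \<open>e\<close>.\<close>

lemma hausdorff_premeasure_UN_eq_0:
  fixes A :: "nat \<Rightarrow> 'a::metric_space set"
  assumes "\<And>i. hausdorff_premeasure d \<delta> (A i) = 0"
  shows "hausdorff_premeasure d \<delta> (\<Union>i. A i) = 0"
proof -
  have "hausdorff_premeasure d \<delta> (\<Union>i. A i) \<le> ennreal e" if e: "e > 0" for e
  proof -
    have "\<exists>U. A i \<subseteq> (\<Union>j. U j) \<and> (\<forall>j. bounded (U j) \<and> diameter (U j) \<le> \<delta>) \<and>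
        (\<Sum>j. hausdorff_gauge d (U j)) < ennreal (e * (1/2) ^ Suc i)" for i
    proof -
      have "hausdorff_premeasure d \<delta> (A i) < ennreal (e * (1/2) ^ Suc i)"
        using assms e by simp
      then show ?thesis
        unfolding hausdorff_premeasure_def INF_less_iff by auto
    qed
    then obtain U where U: "\<And>i. A i \<subseteq> (\<Union>j. U i j)" "\<And>i j. bounded (U i j)"
        "\<And>i j. diameter (U i j) \<le> \<delta>"
        "\<And>i. (\<Sum>j. hausdorff_gauge d (U i j)) < ennreal (e * (1/2) ^ Suc i)"
      by metis
    define V where "V k = case_prod U (prod_decode k)" for k
    have "(\<Union>i. A i) \<subseteq> (\<Union>k. V k)"
    proof
      fix x assume "x \<in> (\<Union>i. A i)"
      then obtain i j where "x \<in> U i j" using U(1) by blast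
      then have "x \<in> V (prod_encode (i, j))" by (simp add: V_def)
      then show "x \<in> (\<Union>k. V k)" by blast
    qed
    then have "hausdorff_premeasure d \<delta> (\<Union>i. A i) \<le> (\<Sum>k. hausdorff_gauge d (V k))"
      by (rule hausdorff_premeasure_le) (simp_all add: V_def U split: prod.split)
    also have "\<dots> = (\<Sum>i. \<Sum>j. hausdorff_gauge d (U i j))"
    proof -
      have "(\<lambda>k. hausdorff_gauge d (V k)) =
          (\<lambda>(i, j). hausdorff_gauge d (U i j)) \<circ> prod_decode"
        by (auto simp: V_def split: prod.split)
      then show ?thesis
        using suminf_ennreal_2dimen[where f = "\<lambda>(i, j). hausdorff_gauge d (U i j)"
            and g = "\<lambda>i. \<Sum>j. hausdorff_gauge d (U i j)"]
        by (simp add: o_def)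
    qed
    also have "\<dots> \<le> (\<Sum>i. ennreal (e * (1/2) ^ Suc i))"
      using U(4) by (intro suminf_le) (auto intro: less_imp_le)
    also have "\<dots> = ennreal e"
      using sums_mult[OF power_half_series, of e] e by (intro suminf_ennreal_eq) auto
    finally show ?thesis .
  qed
  then show ?thesis
    by (metis ennreal_le_epsilon add_0 le_zero_eq)
qed

text \<open>A nonempty \<open>F\<close> is enumerated by \<open>from_nat_into\<close>, possibly with
  repetitions, which are harmless for null sets. The assumption on the empty set settles
  \<open>F = {}\<close>.\<close>

lemma hausdorff_measure_Union_eq_0:
  fixes F :: "'a::metric_space set set"
  assumes "countable F" "\<And>A. A \<in> F \<Longrightarrow> hausdorff_measure d A = 0"
    and "hausdorff_measure d ({} :: 'a set) = 0"
  shows "hausdorff_measure d (\<Union>F) = 0"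
proof (cases "F = {}")
  case False
  then have "hausdorff_premeasure d \<delta> (\<Union>i. from_nat_into F i) = 0" if "\<delta> > 0" for \<delta>
    using assms that
    by (intro hausdorff_premeasure_UN_eq_0) (auto simp: hausdorff_measure_eq_0_iff from_nat_into)
  then show ?thesis
    using False assms(1) by (simp add: hausdorff_measure_eq_0_iff range_from_nat_into)
qed (use assms in simp)

lemma hausdorff_premeasure_finite_cover:
  fixes F :: "'a::metric_space set set"
  assumes F: "finite F" "A \<subseteq> \<Union>F" "\<And>U. U \<in> F \<Longrightarrow> bounded U \<and> diameter U \<le> \<eta>"
    and d: "d > 0" and \<eta>: "0 \<le> \<eta>" "\<eta> \<le> \<delta>"
  shows "hausdorff_premeasure d \<delta> A \<le> ennreal (real (card F) * \<eta> powr d)"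
proof -
  obtain h where h: "bij_betw h {0..<card F} F"
    using ex_bij_betw_nat_finite[OF F(1)] by blast
  \<comment> \<open>Covers are infinite sequences; padding with empty sets costs nothing, since
    their gauge is 0.\<close>
  define U where "U i = (if i < card F then h i else {})" for i
  have mem: "U i \<in> F" if "i < card F" for i
    using h that by (auto simp: U_def bij_betw_def)
  have "hausdorff_premeasure d \<delta> A \<le> (\<Sum>i. hausdorff_gauge d (U i))"
  proof (rule hausdorff_premeasure_le)
    show "A \<subseteq> (\<Union>i. U i)"
    proof
      fix x assume "x \<in> A"
      then obtain V where "V \<in> F" "x \<in> V" using F(2) by blast
      moreover obtain i where "i < card F" "h i = V"
        using h \<open>V \<in> F\<close> by (metis atLeastLessThan_iff bij_betw_iff_bijections)
      ultimately have "i < card F" "x \<in> h i" by auto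
      then have "x \<in> U i" by (simp add: U_def)
      then show "x \<in> (\<Union>i. U i)" by blast
    qed
    show "bounded (U i)" for i
      by (cases "i < card F") (use mem F(3) in \<open>auto simp: U_def\<close>)
    show "diameter (U i) \<le> \<delta>" for i
      by (cases "i < card F") (use mem[of i] F(3)[of "U i"] \<eta> in \<open>auto simp: U_def\<close>)
  qed
  also have "\<dots> = (\<Sum>i<card F. hausdorff_gauge d (U i))"
    by (rule suminf_finite) (auto simp: U_def hausdorff_gauge_def)
  also have "\<dots> \<le> (\<Sum>i<card F. ennreal (\<eta> powr d))"
  proof (rule sum_mono)
    fix i assume "i \<in> {..<card F}"
    then have "bounded (U i)" "diameter (U i) \<le> \<eta>"
      using mem F(3) by auto
    then show "hausdorff_gauge d (U i) \<le> ennreal (\<eta> powr d)"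
      using d by (auto simp: hausdorff_gauge_def diameter_ge_0 intro!: ennreal_leI powr_mono2)
  qed
  also have "\<dots> = ennreal (real (card F) * \<eta> powr d)"
    by (simp add: ennreal_mult' ennreal_of_nat_eq_real_of_nat)
  finally show ?thesis .
qed

section \<open>Lower bound for connected sets\<close>

text \<open>For \<open>d < 1\<close>, a nonempty set of diameter at most 1 has gauge at least its
  diameter. The gauge sum of a cover at scale 1 therefore controls the total length of the images of
  its members under \<open>dist x\<close>, which cover \<open>{0..dist x y}\<close>.\<close>

lemma hausdorff_dim_ge_1:
  fixes A :: "'a::metric_space set"
  assumes "connected A" "x \<in> A" "y \<in> A" "x \<noteq> y"
  shows "hausdorff_dim A \<ge> 1"
  unfolding hausdorff_dim_def
proof (rule INF_greatest)
  fix d :: real assume "d \<in> {d. 0 \<le> d \<and> hausdorff_measure d A = 0}"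
  then have d: "0 \<le> d" and null: "hausdorff_premeasure d 1 A = 0"
    by (auto simp: hausdorff_measure_eq_0_iff)
  have "1 \<le> d"
  proof (rule ccontr)
    assume "\<not> 1 \<le> d"
    have "ennreal (dist x y / 2) \<le> (\<Sum>i. hausdorff_gauge d (U i))"
      if U: "A \<subseteq> (\<Union>i. U i)" "\<And>i. bounded (U i)" "\<And>i. diameter (U i) \<le> 1" for U
    proof -
      define I where "I i = (if U i = {} then {} else
          {dist x (SOME z. z \<in> U i) - diameter (U i)..dist x (SOME z. z \<in> U i) + diameter (U i)})" for i
      have I: "dist x ` U i \<subseteq> I i" for i
      proof
        fix r assume "r \<in> dist x ` U i"
        then obtain z where z: "z \<in> U i" "r = dist x z" by blast
        then have "(SOME z. z \<in> U i) \<in> U i" by (metis someI)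
        then have "dist z (SOME z. z \<in> U i) \<le> diameter (U i)"
          using diameter_bounded_bound[OF U(2)] z by blast
        then have "\<bar>dist x z - dist x (SOME z. z \<in> U i)\<bar> \<le> diameter (U i)"
          by (metis abs_dist_diff_le dist_commute order_trans)
        then show "r \<in> I i" using z by (auto simp: I_def abs_le_iff)
      qed
      have gauge: "emeasure lborel (I i) \<le> 2 * hausdorff_gauge d (U i)" for i
      proof (cases "U i = {}")
        case False
        have D: "0 \<le> diameter (U i)" using U(2) by (rule diameter_ge_0)
        have "ennreal (diameter (U i)) \<le> hausdorff_gauge d (U i)"
        \<comment> \<open>The case \<open>d = 0\<close> is separate because the gauge is then 1 by
          convention; scale 1 ensures that this is at least the diameter.\<close>
        proof (cases "d = 0 \<or> diameter (U i) = 0")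
          case True
          then show ?thesis using False U(3)[of i] by (auto simp: hausdorff_gauge_def)
        next
          case nz: False
          then have "diameter (U i) powr 1 \<le> diameter (U i) powr d"
            using U(3)[of i] D \<open>\<not> 1 \<le> d\<close> by (intro powr_mono') auto
          then show ?thesis
            using nz False D by (auto simp: hausdorff_gauge_def intro!: ennreal_leI)
        qed
        moreover have "emeasure lborel (I i) = 2 * ennreal (diameter (U i))"
          using False D by (simp add: I_def ennreal_mult')
        ultimately show ?thesis by (simp add: mult_left_mono)
      qed (simp add: I_def)
      have "connected (dist x ` A)"
        by (intro connected_continuous_image assms continuous_intros)
      then have "{0..dist x y} \<subseteq> dist x ` A"
        using assms(2,3) by (intro connected_contains_Icc) (auto intro: rev_image_eqI)
      also have "\<dots> \<subseteq> (\<Union>i. dist x ` U i)"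
        using image_mono[OF U(1)] by (simp add: image_UN)
      also have "\<dots> \<subseteq> (\<Union>i. I i)"
        by (rule UN_mono[OF order_refl I])
      finally have "emeasure lborel {0..dist x y} \<le> emeasure lborel (\<Union>i. I i)"
        by (rule emeasure_mono) (auto simp: I_def)
      also have "\<dots> \<le> (\<Sum>i. emeasure lborel (I i))"
        by (rule emeasure_subadditive_countably) (auto simp: I_def)
      also have "\<dots> \<le> (\<Sum>i. 2 * hausdorff_gauge d (U i))"
        by (intro suminf_le gauge) auto
      also have "\<dots> = 2 * (\<Sum>i. hausdorff_gauge d (U i))"
        by (rule ennreal_suminf_cmult)
      finally have "2 * ennreal (dist x y / 2) \<le> 2 * (\<Sum>i. hausdorff_gauge d (U i))"
        by (simp flip: ennreal_mult' ennreal_numeral)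
      then show ?thesis
        by (subst (asm) ennreal_mult_le_mult_iff) auto
    qed
    then have "ennreal (dist x y / 2) \<le> hausdorff_premeasure d 1 A"
      unfolding hausdorff_premeasure_def by (intro INF_greatest) auto
    then show False using null assms by simp
  qed
  then show "1 \<le> ennreal d" by simp
qed

section \<open>Covering arcs by repeated bisection\<close>

text \<open>The induction runs with an upper bound \<open>L\<close> in place of the chord itself:
  both halves then share the bound \<open>c / 2 * L\<close>, even though the actual chord may be
  shorter. The factor \<open>2 * c\<close> comes from the undivided arc, which lies within
  \<open>c * L\<close> of \<open>g s\<close>.\<close>

lemma bisected_arc_cover:
  fixes g :: "real \<Rightarrow> 'a::metric_space"
  assumes g: "continuous_on UNIV g" and c: "0 < c" "c \<le> 2"
    and chord: "\<And>s t u. \<lbrakk>s \<le> u; u \<le> t; dist (g s) (g t) < \<delta>\<rbrakk> \<Longrightarrow>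
      dist (g s) (g u) + dist (g u) (g t) \<le> c * dist (g s) (g t)"
  shows "\<lbrakk>s \<le> t; dist (g s) (g t) \<le> L; L < \<delta>\<rbrakk> \<Longrightarrow>
    \<exists>F. finite F \<and> card F \<le> 2 ^ n \<and> g ` {s..t} \<subseteq> \<Union>F \<and>
      (\<forall>U\<in>F. bounded U \<and> diameter U \<le> 2 * c * L * (c / 2) ^ n)"
proof (induction n arbitrary: s t L)
  case 0
  have *: "dist (g s) (g u) \<le> c * L" if "u \<in> {s..t}" for u
  proof -
    have "dist (g s) (g u) + dist (g u) (g t) \<le> c * dist (g s) (g t)"
      using that 0 by (intro chord) auto
    also have "\<dots> \<le> c * L" using 0 c by simp
    finally show ?thesis using zero_le_dist[of "g u" "g t"] by linarith
  qed
  have "dist (g u) (g v) \<le> 2 * c * L" if "u \<in> {s..t}" "v \<in> {s..t}" for u v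
    using *[OF that(1)] *[OF that(2)] dist_triangle3[of "g u" "g v" "g s"] by simp
  then have "diameter (g ` {s..t}) \<le> 2 * c * L"
    using 0 unfolding diameter_def by (auto intro!: cSUP_least)
  moreover have "bounded (g ` {s..t})"
    by (intro compact_imp_bounded compact_continuous_image continuous_on_subset[OF g]) auto
  ultimately show ?case by (intro exI[of _ "{g ` {s..t}}"]) simp
next
  case (Suc n)
  define L' where "L' = c / 2 * L"
  have "0 \<le> L" using Suc.prems(2) zero_le_dist order_trans by blast
  \<comment> \<open>The difference of the distances to the two endpoints is at most 0 at
    \<open>s\<close> and at least 0 at \<open>t\<close>, so it vanishes at some
    \<open>m\<close>.\<close>
  have "\<exists>m\<ge>s. m \<le> t \<and> dist (g s) (g m) - dist (g m) (g t) = 0"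
    using Suc.prems(1)
    by (intro IVT') (auto intro!: continuous_intros continuous_on_subset[OF g])
  then obtain m where m: "s \<le> m" "m \<le> t" "dist (g s) (g m) = dist (g m) (g t)" by auto
  have "dist (g s) (g m) + dist (g m) (g t) \<le> c * dist (g s) (g t)"
    using m Suc.prems by (intro chord) auto
  also have "\<dots> \<le> c * L" using Suc.prems c by simp
  finally have halves: "dist (g s) (g m) \<le> L'" "dist (g m) (g t) \<le> L'"
    using m(3) by (auto simp: L'_def)
  \<comment> \<open>Because \<open>c \<le> 2\<close>, the half chords stay below \<delta>, and the
    induction hypothesis applies to both halves.\<close>
  have "L' \<le> L" using c mult_right_mono[OF c(2) \<open>0 \<le> L\<close>] by (simp add: L'_def)
  then have "L' < \<delta>" using Suc.prems by simp
  obtain F where F: "finite F" "card F \<le> 2 ^ n" "g ` {s..m} \<subseteq> \<Union>F"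
      "\<forall>U\<in>F. bounded U \<and> diameter U \<le> 2 * c * L' * (c / 2) ^ n"
    using Suc.IH[OF m(1) halves(1) \<open>L' < \<delta>\<close>] by blast
  obtain G where G: "finite G" "card G \<le> 2 ^ n" "g ` {m..t} \<subseteq> \<Union>G"
      "\<forall>U\<in>G. bounded U \<and> diameter U \<le> 2 * c * L' * (c / 2) ^ n"
    using Suc.IH[OF m(2) halves(2) \<open>L' < \<delta>\<close>] by blast
  have "{s..t} = {s..m} \<union> {m..t}" using m by auto
  then have "g ` {s..t} \<subseteq> \<Union>(F \<union> G)"
    using F(3) G(3) by (auto simp: image_Un)
  moreover have "card (F \<union> G) \<le> 2 ^ Suc n"
    using card_Un_le[of F G] F(2) G(2) by simp
  moreover have "\<forall>U\<in>F \<union> G. bounded U \<and> diameter U \<le> 2 * c * L * (c / 2) ^ Suc n"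
  proof -
    have "2 * c * L' * (c / 2) ^ n = 2 * c * L * (c / 2) ^ Suc n" by (simp add: L'_def)
    then show ?thesis using F(4) G(4) by (metis Un_iff)
  qed
  ultimately show ?case using F(1) G(1) by (intro exI[of _ "F \<union> G"]) blast
qed

text \<open>The \<open>n\<close>-th bisection gives at most \<open>2 ^ n\<close> sets of diameter at
  most \<open>K * (c / 2) ^ n\<close>. Their \<open>p\<close>-th powers sum to at most
  \<open>K powr p * r ^ n\<close>, where \<open>r = 2 * (c / 2) powr p < 1\<close>.\<close>

lemma hausdorff_measure_arc_eq_0:
  fixes g :: "real \<Rightarrow> 'a::metric_space"
  assumes g: "continuous_on UNIV g" and c: "0 < c" "c < 2" and p: "p > 0" "2 * (c / 2) powr p < 1"
    and chord: "\<And>s t u. \<lbrakk>s \<le> u; u \<le> t; dist (g s) (g t) < \<delta>\<rbrakk> \<Longrightarrow>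
      dist (g s) (g u) + dist (g u) (g t) \<le> c * dist (g s) (g t)"
    and st: "s \<le> t" "dist (g s) (g t) < \<delta>"
  shows "hausdorff_measure p (g ` {s..t}) = 0"
  unfolding hausdorff_measure_eq_0_iff
proof (intro allI impI)
  fix \<rho> :: real assume "\<rho> > 0"
  define K where "K = 2 * c * dist (g s) (g t)"
  define r where "r = 2 * (c / 2) powr p"
  have "0 \<le> K" using c by (simp add: K_def)
  have "(\<lambda>n. K * (c / 2) ^ n) \<longlonglongrightarrow> K * 0"
    using c by (intro tendsto_intros LIMSEQ_realpow_zero) auto
  \<comment> \<open>From some \<open>n\<close> on, the bisection covers are admissible at scale
    \<rho>.\<close>
  then have small: "\<forall>\<^sub>F n in sequentially. K * (c / 2) ^ n < \<rho>"
    using \<open>\<rho> > 0\<close> by (auto dest: order_tendstoD)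
  have "hausdorff_premeasure p \<rho> (g ` {s..t}) \<le> ennreal (K powr p * r ^ n)"
    if n: "K * (c / 2) ^ n < \<rho>" for n
  proof -
    have "\<exists>F. finite F \<and> card F \<le> 2 ^ n \<and> g ` {s..t} \<subseteq> \<Union>F \<and>
        (\<forall>U\<in>F. bounded U \<and> diameter U \<le> K * (c / 2) ^ n)"
      unfolding K_def using c st by (intro bisected_arc_cover[OF g, of _ \<delta>] chord) auto
    then obtain F where F: "finite F" "card F \<le> 2 ^ n" "g ` {s..t} \<subseteq> \<Union>F"
      "\<forall>U\<in>F. bounded U \<and> diameter U \<le> K * (c / 2) ^ n"
      by blast
    have "hausdorff_premeasure p \<rho> (g ` {s..t}) \<le>
        ennreal (real (card F) * (K * (c / 2) ^ n) powr p)"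
    proof (rule hausdorff_premeasure_finite_cover[OF F(1,3)])
      show "bounded U \<and> diameter U \<le> K * (c / 2) ^ n" if "U \<in> F" for U
        using F(4) that by blast
      show "0 \<le> K * (c / 2) ^ n" using c \<open>0 \<le> K\<close> by simp
      show "K * (c / 2) ^ n \<le> \<rho>" using n by simp
    qed (use p in simp)
    also have "\<dots> \<le> ennreal (2 ^ n * (K * (c / 2) ^ n) powr p)"
    proof (intro ennreal_leI mult_right_mono)
      show "real (card F) \<le> 2 ^ n"
        using F(2) by (metis of_nat_le_iff of_nat_numeral of_nat_power)
    qed simp
    also have "2 ^ n * (K * (c / 2) ^ n) powr p = K powr p * r ^ n"
    proof -
      have "((c / 2) ^ n) powr p = ((c / 2) powr p) ^ n"
        using c by (subst (1 2) powr_realpow[symmetric]) (auto simp: powr_powr mult.commute)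
      then show ?thesis
        using c \<open>0 \<le> K\<close> by (simp add: r_def powr_mult power_mult_distrib)
    qed
    finally show ?thesis .
  qed
  then have bound: "\<forall>\<^sub>F n in sequentially.
      hausdorff_premeasure p \<rho> (g ` {s..t}) \<le> ennreal (K powr p * r ^ n)"
    using small by (auto elim: eventually_mono)
  have "(\<lambda>n. K powr p * r ^ n) \<longlonglongrightarrow> K powr p * 0"
    using p by (intro tendsto_intros LIMSEQ_realpow_zero) (auto simp: r_def)
  then have "(\<lambda>n. ennreal (K powr p * r ^ n)) \<longlonglongrightarrow> ennreal 0"
    by (intro tendsto_ennrealI) simp
  then have "hausdorff_premeasure p \<rho> (g ` {s..t}) \<le> ennreal 0"
    using bound by (rule tendsto_lowerbound) simp
  then show "hausdorff_premeasure p \<rho> (g ` {s..t}) = 0" by simp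
qed

text \<open>Continuity makes chords locally short, so the curve is a countable union of arcs to
  which the bisection argument applies.\<close>

lemma hausdorff_measure_curve_eq_0:
  fixes g :: "real \<Rightarrow> 'a::metric_space"
  assumes g: "continuous_on UNIV g" and p: "p > 1"
    and chord: "\<And>c. c > 1 \<Longrightarrow> \<exists>\<delta>>0. \<forall>s t. \<forall>u\<in>{s..t}. dist (g s) (g t) < \<delta> \<longrightarrow>
      dist (g s) (g u) + dist (g u) (g t) \<le> c * dist (g s) (g t)"
  shows "hausdorff_measure p (range g) = 0"
proof -
  \<comment> \<open>With this exponent, \<open>2 * (c / 2) powr p\<close> equals
    \<open>2 powr (- (p - 1) / 2)\<close>, which is below 1, while \<open>c\<close> still exceeds
    1.\<close>
  define c :: real where "c = 2 powr ((p - 1) / (2 * p))"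
  have "c > 1" using p by (simp add: c_def)
  have "c < 2 powr 1"
    unfolding c_def using p by (intro powr_less_mono) (auto simp: divide_simps)
  then have "c < 2" by simp
  have "2 * (c / 2) powr p = 2 powr (1 + (p - 1) / 2 - p)"
    using p by (simp add: c_def powr_divide powr_powr powr_add powr_diff)
  also have "\<dots> < 2 powr 0"
    using p by (intro powr_less_mono) (auto simp: field_simps)
  finally have r: "2 * (c / 2) powr p < 1" by simp
  obtain \<delta> where \<delta>: "\<delta> > 0" and ch: "\<And>s t u. \<lbrakk>s \<le> u; u \<le> t; dist (g s) (g t) < \<delta>\<rbrakk> \<Longrightarrow>
      dist (g s) (g u) + dist (g u) (g t) \<le> c * dist (g s) (g t)"
    using chord[OF \<open>c > 1\<close>] by (metis atLeastAtMost_iff)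
  \<comment> \<open>Rational parameters keep the family of arcs countable; only the chord between
    the endpoints has to be short.\<close>
  define R where "R = {(s, t). s \<in> \<rat> \<and> t \<in> \<rat> \<and> s \<le> t \<and> dist (g s) (g t) < \<delta>}"
  have null: "hausdorff_measure p (g ` {s..t}) = 0" if "(s, t) \<in> R" for s t
  proof (rule hausdorff_measure_arc_eq_0[OF g _ \<open>c < 2\<close> _ r])
    show "dist (g x) (g z) + dist (g z) (g y) \<le> c * dist (g x) (g y)"
      if "x \<le> z" "z \<le> y" "dist (g x) (g y) < \<delta>" for x y z
      using that by (rule ch)
  qed (use that \<open>c > 1\<close> p in \<open>auto simp: R_def\<close>)
  have "R \<subseteq> \<rat> \<times> \<rat>" by (auto simp: R_def)
  then have "countable R"
    using countable_SIGMA[OF countable_rat countable_rat] by (rule countable_subset)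
  have "range g = \<Union>((\<lambda>(s, t). g ` {s..t}) ` R)"
  proof (intro equalityI subsetI)
    fix x assume "x \<in> range g"
    then obtain u where u: "x = g u" by blast
    obtain e where e: "e > 0" "\<And>v. dist v u < e \<Longrightarrow> dist (g v) (g u) < \<delta> / 2"
      using g \<delta> unfolding continuous_on_iff by (metis UNIV_I half_gt_zero)
    obtain s where s: "s \<in> \<rat>" "u - e < s" "s < u"
      using Rats_dense_in_real[of "u - e" u] e(1) by auto
    obtain t where t: "t \<in> \<rat>" "u < t" "t < u + e"
      using Rats_dense_in_real[of u "u + e"] e(1) by auto
    have "dist (g s) (g u) < \<delta> / 2" "dist (g t) (g u) < \<delta> / 2"
      using s t by (intro e(2); simp add: dist_real_def)+
    then have "dist (g s) (g t) < \<delta>" by (rule dist_triangle_half_l)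
    then have "(s, t) \<in> R" using s t by (simp add: R_def)
    then show "x \<in> \<Union>((\<lambda>(s, t). g ` {s..t}) ` R)"
      using u s t by (intro UN_I[of "(s, t)"]) auto
  qed auto
  moreover have "hausdorff_measure p ({} :: 'a set) = 0"
  proof -
    have "hausdorff_premeasure p \<rho> ({} :: 'a set) = 0" if "\<rho> > 0" for \<rho>
      using hausdorff_premeasure_finite_cover[of "{}" "{}" 0 p \<rho>] p that by simp
    then show ?thesis by (simp add: hausdorff_measure_eq_0_iff)
  qed
  ultimately show ?thesis
    using \<open>countable R\<close> null by (auto intro!: hausdorff_measure_Union_eq_0)
qed

section \<open>Asymptotically conformal quasicircles\<close>

theorem corollary6p2:
  fixes \<Gamma> :: "complex set"
  assumes "unbounded_quasicircle \<Gamma>"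
    and "asymptotically_conformal \<Gamma>"
  shows "hausdorff_dim \<Gamma> = 1"
proof (rule antisym)
  obtain f h :: "complex \<Rightarrow> complex" where f: "homeomorphism UNIV UNIV f h" and \<Gamma>: "\<Gamma> = f ` \<real>"
    using assms(1) unfolding unbounded_quasicircle_def quasiconformal_def by blast
  define g where "g = f \<circ> complex_of_real"
  have contf: "continuous_on UNIV f" and "inj f"
    using f by (auto simp: homeomorphism_def intro: inj_on_inverseI)
  have g: "continuous_on UNIV g"
    unfolding g_def
    by (intro continuous_on_compose continuous_intros continuous_on_subset[OF contf]) auto
  have "inj g" using \<open>inj f\<close> unfolding g_def by (intro inj_compose inj_of_real)
  have \<Gamma>g: "\<Gamma> = range g" by (auto simp: \<Gamma> g_def Reals_def)
  have chord: "\<exists>\<delta>>0. \<forall>s t. \<forall>u\<in>{s..t}. dist (g s) (g t) < \<delta> \<longrightarrow>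
      dist (g s) (g u) + dist (g u) (g t) \<le> c * dist (g s) (g t)" if "c > 1" for c
  proof -
    have "0 < c - 1" using \<open>c > 1\<close> by simp
    then obtain \<delta> where "\<delta> > 0" and \<delta>: "\<forall>a\<in>\<Gamma>. \<forall>b\<in>\<Gamma>. 0 < norm (a - b) \<and> norm (a - b) < \<delta> \<longrightarrow>
        \<bar>(SUP w \<in> subarc \<Gamma> a b. (norm (a - w) + norm (w - b)) / norm (a - b)) - 1\<bar> < c - 1"
      using assms(2) unfolding asymptotically_conformal_def by (elim allE[of _ "c - 1"] impE exE conjE) simp_all
    have "dist (g s) (g u) + dist (g u) (g t) \<le> c * dist (g s) (g t)"
      if u: "u \<in> {s..t}" and st: "dist (g s) (g t) < \<delta>" for s t u
    \<comment> \<open>Asymptotic conformality concerns distinct endpoints only; for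
      \<open>s = t\<close> also \<open>u = s\<close>, and all distances vanish.\<close>
    proof (cases "s = t")
      case False
      let ?q = "\<lambda>w. (norm (g s - w) + norm (w - g t)) / norm (g s - g t)"
      have pos: "0 < norm (g s - g t)" using False \<open>inj g\<close> by (simp add: inj_eq)
      have arc: "subarc \<Gamma> (g s) (g t) = g ` {s..t}"
        using subarc_homeomorphic_image[OF f False] u
        by (simp add: \<Gamma> g_def closed_segment_eq_real_ivl)
      \<comment> \<open>A real supremum dominates its members only if the set is bounded above,
        which compactness of the arc provides.\<close>
      have "compact (?q ` g ` {s..t})"
        using pos by (intro compact_continuous_image continuous_intros continuous_on_subset[OF g]) auto
      then have "bdd_above (?q ` g ` {s..t})"
        by (intro bounded_imp_bdd_above compact_imp_bounded)
      then have "?q (g u) \<le> (SUP w \<in> g ` {s..t}. ?q w)"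
        using u by (intro cSUP_upper) auto
      also have "\<dots> < c"
      proof -
        have "\<bar>(SUP w \<in> subarc \<Gamma> (g s) (g t). ?q w) - 1\<bar> < c - 1"
          using pos st by (intro \<delta>[rule_format]) (auto simp: \<Gamma>g dist_norm)
        then show ?thesis unfolding arc by linarith
      qed
      finally show ?thesis using pos by (simp add: dist_norm divide_simps)
    qed (use u in simp)
    then show ?thesis using \<open>\<delta> > 0\<close> by blast
  qed
  have dim: "hausdorff_dim \<Gamma> \<le> ennreal p" if "p > 1" for p
    unfolding hausdorff_dim_def
    using hausdorff_measure_curve_eq_0[OF g that chord] that by (intro INF_lower) (simp add: \<Gamma>g)
  show "hausdorff_dim \<Gamma> \<le> 1"
  \<comment> \<open>The curve is null for every exponent \<open>p > 1\<close>, so the dimension is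
    at most \<open>1 + e\<close> for every \<open>e > 0\<close>.\<close>
  proof (rule ennreal_le_epsilon)
    fix e :: real assume "e > 0"
    then show "hausdorff_dim \<Gamma> \<le> 1 + ennreal e"
      using dim[of "1 + e"] by (simp add: ennreal_plus)
  qed
  have "connected \<Gamma>"
    unfolding \<Gamma>g by (rule connected_continuous_image[OF g]) simp
  moreover have "g 0 \<noteq> g 1" using \<open>inj g\<close> by (simp add: inj_eq)
  ultimately show "1 \<le> hausdorff_dim \<Gamma>"
    by (intro hausdorff_dim_ge_1) (auto simp: \<Gamma>g)
qed

end
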